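(* Let $\varphi:\mathbb{P}^1\times\mathbb{P}^1\dashrightarrow\mathbb{P}^1\times\mathbb{P}^1$ be a dominant rational mapping over $\mathbb{C}$, $\varphi(x,y)=(\bar{x},\bar{y})$. For $\bar{x}_1\neq\bar{x}_2\in\mathbb{P}^1$ and $\bar{y}_1\neq\bar{y}_2\in\mathbb{P}^1$ consider the divisors $\bar{D}_1=V(\bar{x}-\bar{x}_1)$, $\bar{D}_2=V(\bar{x}-\bar{x}_2)$, $\bar{D}_3=V(\bar{y}-\bar{y}_1)$, $\bar{D}_4=V(\bar{y}-\bar{y}_2)$. Let their pull-backs be written as sums of distinct irreducible divisors $$\varphi^*(\bar{D}_i)=m_{i,1}D_{i,1}+\cdots+m_{i,S_i}D_{i,S_i},\qquad m_{i,j}\in\mathbb{N},$$ and let $p_{i,j}(x,y)$ be an irreducible defining polynomial of $D_{i,j}$, $D_{i,j}=V(p_{i,j}(x,y))$. Then the mapping $\varphi$ is given implicitly by $$\frac{\bar{l}_1(\bar{x})}{\bar{l}_2(\bar{x})}=C_1\,\frac{\prod_{s=1}^{S_1}p_{1,s}(x,y)^{m_{1,s}}}{\prod_{s=1}^{S_2}p_{2,s}(x,y)^{m_{2,s}}},\qquad \frac{\bar{l}_1(\bar{y})}{\bar{l}_2(\bar{y})}=C_2\,\frac{\prod_{s=1}^{S_3}p_{3,s}(x,y)^{m_{3,s}}}{\prod_{s=1}^{S_4}p_{4,s}(x,y)^{m_{4,s}}},$$ where $C_1,C_2$ are some non-zero constants, which can be computed if one also knows the pull-backs of $V(\bar{x}-\bar{x}_3)$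 and $V(\bar{y}-\bar{y}_3)$ for some other points $\bar{x}_3$ (different from $\bar{x}_1,\bar{x}_2$) and $\bar{y}_3$ (different from $\bar{y}_1,\bar{y}_2$).
   Context: Here $x,y$ (and $\bar{x},\bar{y}$ on the target) are the standard affine coordinates on the two factors of $\mathbb{P}^1\times\mathbb{P}^1$, and points of $\mathbb{P}^1$ are allowed to be $\infty$. $V(f)$ denotes the zero divisor of $f$; $V(\bar{x}-\bar{x}_i)$ is the line $\{\bar{x}=\bar{x}_i\}$, which for $\bar{x}_i=\infty$ means $\{\bar{x}=\infty\}$; similarly for $\bar{y}$. Pull-back of divisors: write each component of $\varphi$ in homogeneous coordinates by a pair of coprime bihomogeneous polynomials of the same bidegree; the pull-back $\varphi^*(V(\bar{x}-\bar{x}_i))$ is the zero divisor (with multiplicities) of the bihomogeneous polynomial obtained by substituting these polynomials into the homogeneous linear form defining $\bar{x}_i$; similarly for $\bar{y}$. Affine conventions: $\bar{l}_i(\bar{x})=\bar{x}-\bar{x}_i$ if $\bar{x}_i\neq\infty$ and $\bar{l}_i(\bar{x})=1$ if $\bar{x}_i=\infty$; likewise $\bar{l}_i(\bar{y})=\bar{y}-\bar{y}_i$ if $\bar{y}_i\ne\infty$ and $\bar{l}_i(\bar{y})=1$ if $\bar{y}_i=\infty$. In the affine formula, the irreducible defining polynomial of a divisor is the dehomogenization of its irreducible bihomogeneous defining polynomial; in particular it equals $1$ for the divisors $\{x=\infty\}$ and $\{y=\infty\}$. *)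

theory Defs
  imports "HOL-Computational_Algebra.Computational_Algebra" "HOL-Computational_Algebra.Field_as_Ring"
begin

section \<open>Points and bihomogeneous polynomials\<close>

datatype proj_line = Fin complex | Infty

fun hcoords :: "proj_line \<Rightarrow> complex \<times> complex" where
  "hcoords (Fin a) = (a, 1)"
| "hcoords Infty = (1, 0)"

definition point_of_ratio :: "complex \<Rightarrow> complex \<Rightarrow> proj_line" where
  "point_of_ratio u v = (if v = 0 then Infty else Fin (u / v))"

text \<open>
  Polynomials in the homogeneous coordinates \<open>[X0 : X1]\<close>, \<open>[Y0 : Y1]\<close> of the two factors,
  where \<open>x = X0 / X1\<close> and \<open>y = Y0 / Y1\<close>. From the outermost to the innermost, the variables are
  \<open>X1\<close>, \<open>Y1\<close>, \<open>X0\<close>, \<open>Y0\<close>. With this order, setting \<open>X1 = Y1 = 1\<close> leaves a polynomial in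
  \<open>x\<close> (outer variable) and \<open>y\<close> (inner variable).
\<close>
type_synonym hpoly = "complex poly poly poly poly"

definition hconst :: "complex \<Rightarrow> hpoly" where
  "hconst c = [:[:[:[:c:]:]:]:]"

definition bihomogeneous_of :: "nat \<Rightarrow> nat \<Rightarrow> hpoly \<Rightarrow> bool" where
  "bihomogeneous_of a b H \<longleftrightarrow>
     (\<forall>i j k l. coeff (coeff (coeff (coeff H i) j) k) l \<noteq> 0 \<longrightarrow> i + k = a \<and> j + l = b)"

definition bihomogeneous :: "hpoly \<Rightarrow> bool" where
  "bihomogeneous H \<longleftrightarrow> (\<exists>a b. bihomogeneous_of a b H)"

text \<open>The value of \<open>H\<close> at \<open>X0 = u\<close>, \<open>X1 = v\<close>, \<open>Y0 = w\<close>, \<open>Y1 = z\<close>.\<close>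
definition heval :: "hpoly \<Rightarrow> complex \<times> complex \<Rightarrow> complex \<times> complex \<Rightarrow> complex" where
  "heval H = (\<lambda>(u, v) (w, z). poly (poly (poly (poly H [:[:[:v:]:]:]) [:[:z:]:]) [:u:]) w)"

definition value_at :: "hpoly \<Rightarrow> proj_line \<times> proj_line \<Rightarrow> complex" where
  "value_at H q = heval H (hcoords (fst q)) (hcoords (snd q))"

definition zero_locus :: "hpoly \<Rightarrow> (proj_line \<times> proj_line) set" where
  "zero_locus H = {q. value_at H q = 0}"

definition dehomogenize :: "hpoly \<Rightarrow> complex poly poly" where
  "dehomogenize H = poly (poly H 1) 1"


section \<open>Divisors\<close>

definition prime_divisor :: "(proj_line \<times> proj_line) set \<Rightarrow> bool" where
  "prime_divisor D \<longleftrightarrow> (\<exists>P. irreducible P \<and> bihomogeneous P \<and> zero_locus P = D)"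

definition defining_poly :: "(proj_line \<times> proj_line) set \<Rightarrow> hpoly" where
  "defining_poly D = (SOME P. irreducible P \<and> bihomogeneous P \<and> zero_locus P = D)"

text \<open>
  An effective divisor is given by its coefficients along the prime divisors, with value 0 on all
  sets that are not prime divisors. The polynomial \<open>defining_poly D\<close> is unique up to a unit, which
  does not affect the multiplicity.
\<close>
type_synonym divisor = "(proj_line \<times> proj_line) set \<Rightarrow> nat"

definition zero_divisor :: "hpoly \<Rightarrow> divisor" where
  "zero_divisor H = (\<lambda>D. if prime_divisor D then multiplicity (defining_poly D) H else 0)"

definition divisor_of_prime :: "(proj_line \<times> proj_line) set \<Rightarrow> divisor" where
  "divisor_of_prime D = (\<lambda>D'. if D' = D then 1 else 0)"

definition div_support :: "divisor \<Rightarrow> (proj_line \<times> proj_line) set" where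
  "div_support E = \<Union>{D. E D \<noteq> 0}"

text \<open>
  \<open>E = m 1 D\<^sub>1 + \<dots> + m n D\<^sub>n\<close> with distinct irreducible divisors \<open>D\<^sub>j = V(P j)\<close>, where each \<open>P j\<close> is
  an irreducible bihomogeneous polynomial, fixed only up to a scalar.
\<close>
definition prime_decomposition ::
    "divisor \<Rightarrow> nat \<Rightarrow> (nat \<Rightarrow> nat) \<Rightarrow> (nat \<Rightarrow> hpoly) \<Rightarrow> bool" where
  "prime_decomposition E n m P \<longleftrightarrow>
     (\<forall>j\<in>{1..n}. irreducible (P j) \<and> bihomogeneous (P j)) \<and>
     inj_on (\<lambda>j. zero_locus (P j)) {1..n} \<and>
     E = (\<lambda>D. \<Sum>j=1..n. m j * divisor_of_prime (zero_locus (P j)) D)"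


section \<open>Rational maps\<close>

text \<open>
  The map with components \<open>[num_x : den_x]\<close> and \<open>[num_y : den_y]\<close>, i.e. in affine coordinates
  of the target its components are \<open>num_x / den_x\<close> and \<open>num_y / den_y\<close>.
\<close>
record biproj_map =
  num_x :: hpoly
  den_x :: hpoly
  num_y :: hpoly
  den_y :: hpoly

definition rational_map :: "biproj_map \<Rightarrow> bool" where
  "rational_map \<phi> \<longleftrightarrow>
     coprime (num_x \<phi>) (den_x \<phi>) \<and>
     (\<exists>a b. bihomogeneous_of a b (num_x \<phi>) \<and> bihomogeneous_of a b (den_x \<phi>)) \<and>
     coprime (num_y \<phi>) (den_y \<phi>) \<and>
     (\<exists>a b. bihomogeneous_of a b (num_y \<phi>) \<and> bihomogeneous_of a b (den_y \<phi>))"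

definition map_domain :: "biproj_map \<Rightarrow> (proj_line \<times> proj_line) set" where
  "map_domain \<phi> = {q. (value_at (num_x \<phi>) q \<noteq> 0 \<or> value_at (den_x \<phi>) q \<noteq> 0) \<and>
                       (value_at (num_y \<phi>) q \<noteq> 0 \<or> value_at (den_y \<phi>) q \<noteq> 0)}"

definition map_at :: "biproj_map \<Rightarrow> proj_line \<times> proj_line \<Rightarrow> proj_line \<times> proj_line" where
  "map_at \<phi> q =
     (point_of_ratio (value_at (num_x \<phi>) q) (value_at (den_x \<phi>) q),
      point_of_ratio (value_at (num_y \<phi>) q) (value_at (den_y \<phi>) q))"

text \<open>Every Zariski closed set is an intersection of zero loci of bihomogeneous polynomials.\<close>
definition zariski_dense :: "(proj_line \<times> proj_line) set \<Rightarrow> bool" where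
  "zariski_dense A \<longleftrightarrow> (\<forall>H. bihomogeneous H \<and> A \<subseteq> zero_locus H \<longrightarrow> zero_locus H = UNIV)"

definition dominant :: "biproj_map \<Rightarrow> bool" where
  "dominant \<phi> \<longleftrightarrow> zariski_dense (map_at \<phi> ` map_domain \<phi>)"

text \<open>
  The homogeneous linear form in \<open>U\<close>, \<open>V\<close> that defines a point of the projective line; \<open>emb\<close>
  embeds the scalars into the ring in which \<open>U\<close> and \<open>V\<close> are taken.
\<close>
fun linear_form :: "(complex \<Rightarrow> 'a) \<Rightarrow> proj_line \<Rightarrow> 'a \<times> 'a \<Rightarrow> 'a::comm_ring_1" where
  "linear_form emb (Fin a) (U, V) = U - emb a * V"
| "linear_form emb Infty (U, V) = V"

definition pullback_x :: "biproj_map \<Rightarrow> proj_line \<Rightarrow> divisor" where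
  "pullback_x \<phi> p = zero_divisor (linear_form hconst p (num_x \<phi>, den_x \<phi>))"

definition pullback_y :: "biproj_map \<Rightarrow> proj_line \<Rightarrow> divisor" where
  "pullback_y \<phi> p = zero_divisor (linear_form hconst p (num_y \<phi>, den_y \<phi>))"


section \<open>The affine formula in the function field\<close>

type_synonym ratfun = "complex poly poly fract"

definition rconst :: "complex \<Rightarrow> ratfun" where
  "rconst c = to_fract [:[:c:]:]"

definition affine_x :: "biproj_map \<Rightarrow> ratfun" where
  "affine_x \<phi> = to_fract (dehomogenize (num_x \<phi>)) / to_fract (dehomogenize (den_x \<phi>))"

definition affine_y :: "biproj_map \<Rightarrow> ratfun" where
  "affine_y \<phi> = to_fract (dehomogenize (num_y \<phi>)) / to_fract (dehomogenize (den_y \<phi>))"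

fun lbar :: "proj_line \<Rightarrow> ratfun \<Rightarrow> ratfun" where
  "lbar (Fin a) \<xi> = \<xi> - rconst a"
| "lbar Infty \<xi> = 1"

definition prime_prod :: "nat \<Rightarrow> (nat \<Rightarrow> nat) \<Rightarrow> (nat \<Rightarrow> hpoly) \<Rightarrow> hpoly" where
  "prime_prod n m P = (\<Prod>s=1..n. P s ^ m s)"

text \<open>
  The value of \<open>l\<^sub>1 / l\<^sub>2\<close> at the point \<open>p3\<close>, where \<open>l\<^sub>i\<close> is the affine linear form of \<open>p\<^sub>i\<close>;
  for \<open>p3 = Infty\<close> this is the limit at infinity.
\<close>
definition linear_ratio_at :: "proj_line \<Rightarrow> proj_line \<Rightarrow> proj_line \<Rightarrow> complex" where
  "linear_ratio_at p1 p2 p3 =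
     linear_form (\<lambda>c. c) p1 (hcoords p3) / linear_form (\<lambda>c. c) p2 (hcoords p3)"

text \<open>
  How the constant \<open>C\<close> is computed from the three pull-backs \<open>E1\<close>, \<open>E2\<close>, \<open>E3\<close> of \<open>p1\<close>, \<open>p2\<close>, \<open>p3\<close>,
  when \<open>A\<close>, \<open>B\<close> are the products of the chosen defining polynomials of \<open>E1\<close>, \<open>E2\<close>: evaluate
  \<open>l\<^sub>1 / l\<^sub>2 = C A / B\<close> at any point of \<open>E3\<close> which is not on \<open>E1\<close> or \<open>E2\<close>. Since \<open>A\<close> and \<open>B\<close> have
  the same bidegree, their ratio does not depend on the homogeneous coordinates of the point;
  these are needed because \<open>E3\<close> may lie at infinity.
\<close>
definition computed_from_third ::
    "complex \<Rightarrow> proj_line \<Rightarrow> proj_line \<Rightarrow> proj_line \<Rightarrow> divisor \<Rightarrow> divisor \<Rightarrow> divisor \<Rightarrow>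
     hpoly \<Rightarrow> hpoly \<Rightarrow> bool" where
  "computed_from_third C p1 p2 p3 E1 E2 E3 A B \<longleftrightarrow>
     div_support E3 - div_support E1 - div_support E2 \<noteq> {} \<and>
     (\<forall>q \<in> div_support E3 - div_support E1 - div_support E2.
        value_at A q \<noteq> 0 \<and> C = linear_ratio_at p1 p2 p3 * value_at B q / value_at A q)"

end

theory Submission
  imports Defs
begin

text \<open>
  Write a component of the map as \<open>[N : D]\<close>. The pull-back of a point \<open>p\<close> is the divisor of the
  bihomogeneous polynomial \<open>L p\<close> that is obtained by substituting \<open>N\<close>, \<open>D\<close> into the linear form of
  \<open>p\<close>. In a factorial ring a bihomogeneous polynomial is determined by its divisor up to a constant,
  so \<open>L p1 = c1 A\<close> and \<open>L p2 = c2 B\<close>, where \<open>A\<close>, \<open>B\<close> are the products of the given irreducible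
  polynomials (\<open>prime_decomposition_zero_divisorD\<close>). Dehomogenizing, the ratio of the affine linear
  forms at \<open>\<xi> = N / D\<close> is \<open>L p1 / L p2 = (c1 / c2) A / B\<close>. Conversely this ratio determines
  \<open>\<xi>\<close>, being a Moebius transformation of it. At a zero of \<open>L p3\<close> the values of \<open>N\<close> and \<open>D\<close> are
  proportional to the coordinates of \<open>p3\<close>, which gives the value of \<open>L p1 / L p2\<close> there and thus the
  constant (\<open>pencil_formula\<close>).

  Divisors are indexed here by sets of points, and two facts connect these sets with divisibility.
  Irreducible factors of bihomogeneous polynomials are bihomogeneous (\<open>bihomogeneous_factor\<close>), so
  that each of them has a zero locus. And a bihomogeneous polynomial that vanishes on the zero locus
  of a prime one is divisible by it (\<open>prime_elem_dvd_if_zero_locus_subset\<close>); this Nullstellensatz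
  for hypersurfaces is proved by induction on the number of variables, by eliminating the last one.
  It shows that primes with the same zero locus are associated, so that a divisor has a well-defined
  coefficient at each locus, and that the divisor of \<open>p3\<close> is not contained in that of \<open>p1\<close>.

  Dominance ensures that no \<open>L p\<close> is zero (\<open>dominant_linear_form_nonzero\<close>), and hence that none is
  constant.
\<close>


section \<open>Ring homomorphisms on iterated polynomial rings\<close>

locale comm_ring_hom =
  fixes \<phi> :: "'a::comm_ring_1 \<Rightarrow> 'b::comm_ring_1"
  assumes hom_one [simp]: "\<phi> 1 = 1"
    and hom_add [simp]: "\<phi> (a + b) = \<phi> a + \<phi> b"
    and hom_mult [simp]: "\<phi> (a * b) = \<phi> a * \<phi> b"
begin

lemma hom_zero [simp]: "\<phi> 0 = 0"
  using hom_add[of 0 0] by (simp del: hom_add)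

lemma hom_minus [simp]: "\<phi> (- a) = - \<phi> a"
  using hom_add[of a "- a"] by (simp del: hom_add add: eq_neg_iff_add_eq_0 add.commute)

lemma hom_diff [simp]: "\<phi> (a - b) = \<phi> a - \<phi> b"
  using hom_add[of a "- b"] by (simp del: hom_add)

lemma hom_dvd: "a dvd b \<Longrightarrow> \<phi> a dvd \<phi> b"
  by (auto elim!: dvdE)

end

lemma comm_ring_hom_compose:
  assumes "comm_ring_hom f" "comm_ring_hom g"
  shows "comm_ring_hom (\<lambda>x. f (g x))"
proof -
  interpret f: comm_ring_hom f by fact
  interpret g: comm_ring_hom g by fact
  show ?thesis by unfold_locales simp_all
qed

text \<open>
  The homomorphism on \<open>R[X]\<close> that is \<open>\<phi>\<close> on \<open>R\<close> and sends \<open>X\<close> to \<open>x\<close>. Applied once for every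
  variable, it produces both the evaluations at points and the gradings of the ring \<open>hpoly\<close>, so
  that facts about either can be proved one variable at a time.
\<close>
definition extend_hom :: "('a::comm_ring_1 \<Rightarrow> 'b::comm_ring_1) \<Rightarrow> 'b \<Rightarrow> 'a poly \<Rightarrow> 'b" where
  "extend_hom \<phi> x p = poly (map_poly \<phi> p) x"

context comm_ring_hom
begin

lemma extend_hom_0 [simp]: "extend_hom \<phi> x 0 = 0"
  by (simp add: extend_hom_def)

lemma extend_hom_pCons [simp]: "extend_hom \<phi> x (pCons a p) = \<phi> a + x * extend_hom \<phi> x p"
  by (simp add: extend_hom_def map_poly_pCons)

lemma extend_hom_add: "extend_hom \<phi> x (p + q) = extend_hom \<phi> x p + extend_hom \<phi> x q"
  by (induction p q rule: poly_induct2) (simp_all add: algebra_simps)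

lemma extend_hom_smult: "extend_hom \<phi> x (smult a p) = \<phi> a * extend_hom \<phi> x p"
  by (induction p) (simp_all add: algebra_simps)

lemma extend_hom_mult: "extend_hom \<phi> x (p * q) = extend_hom \<phi> x p * extend_hom \<phi> x q"
  by (induction p) (simp_all add: algebra_simps extend_hom_add extend_hom_smult)

lemma comm_ring_hom_extend_hom: "comm_ring_hom (extend_hom \<phi> x)"
  by unfold_locales (simp_all add: extend_hom_add extend_hom_mult one_pCons)

lemma hom_poly_eq_extend_hom: "\<phi> (poly p c) = extend_hom \<phi> (\<phi> c) p"
  by (induction p) simp_all

end

section \<open>Prime elements and their zeros\<close>

text \<open>
  A nonzero element \<open>G\<close> of least degree in the ideal \<open>(P, H)\<close> divides, up to a nonzero scalar, both
  \<open>P\<close> and \<open>H\<close>, by pseudo-division. As \<open>P\<close> is prime and does not divide \<open>H\<close>, it cannot divide \<open>G\<close>,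
  so it divides the cofactor in \<open>a P = G k\<close>; then \<open>G\<close> divides the scalar \<open>a\<close> and is a constant.
\<close>
lemma prime_elem_eliminant:
  fixes P H :: "'a::idom poly"
  assumes "prime_elem P" "degree P > 0" "\<not> P dvd H"
  obtains S T r where "r \<noteq> 0" "S * P + T * H = [:r:]"
proof -
  define I where "I = {G. G \<noteq> 0 \<and> (\<exists>S T. G = S * P + T * H)}"
  have "P \<noteq> 0" using assms(1) by auto
  moreover have "P = 1 * P + 0 * H" by simp
  ultimately have "P \<in> I" unfolding I_def by blast
  then obtain G where G: "G \<in> I" and G_min: "\<And>F. F \<in> I \<Longrightarrow> degree G \<le> degree F"
    using ex_has_least_nat[of "\<lambda>G. G \<in> I" P degree] by blast
  have G_nz: "G \<noteq> 0" using G by (simp add: I_def)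
  from G obtain S T where ST: "G = S * P + T * H" by (auto simp: I_def)
  have divides: "\<exists>a q. a \<noteq> 0 \<and> [:a:] * F = G * q" if "F = A * P + B * H" for F A B
  proof -
    obtain a q where aq: "a \<noteq> 0" "smult a F = G * q + pseudo_mod F G"
      using pseudo_mod(1)[OF G_nz] by blast
    have "pseudo_mod F G = (smult a A - q * S) * P + (smult a B - q * T) * H"
      using aq(2) by (simp add: that ST algebra_simps smult_add_right)
    hence "pseudo_mod F G \<in> I \<or> pseudo_mod F G = 0"
      unfolding I_def by blast
    with pseudo_mod(2)[OF G_nz, of F] G_min have "pseudo_mod F G = 0"
      by (meson leD)
    with aq show ?thesis by (intro exI[of _ a] exI[of _ q]) simp
  qed
  from divides[of P 1 0] obtain a k where a: "a \<noteq> 0" "[:a:] * P = G * k" by auto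
  from divides[of H 0 1] obtain b l where b: "b \<noteq> 0" "[:b:] * H = G * l" by auto
  have "\<not> P dvd G"
  proof
    assume "P dvd G"
    hence "P dvd [:b:] * H" using b by simp
    with assms(1,3) have "P dvd [:b:]" using prime_elem_dvd_multD by blast
    hence "degree P \<le> degree [:b:]" using b by (intro dvd_imp_degree_le) auto
    thus False using assms(2) by simp
  qed
  moreover have "P dvd G * k" using a(2) by (metis dvd_triv_right)
  ultimately have "P dvd k" using assms(1) prime_elem_dvd_multD by blast
  then obtain k' where "k = P * k'" by blast
  hence "P * [:a:] = P * (G * k')" using a(2) by (simp only: mult_ac)
  hence "[:a:] = G * k'" using \<open>P \<noteq> 0\<close> by (metis mult_left_cancel)
  hence "G dvd [:a:]" by simp
  hence "degree G \<le> degree [:a:]" using a by (intro dvd_imp_degree_le) auto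
  hence "degree G = 0" by simp
  then obtain r where r: "G = [:r:]" by (rule degree_eq_zeroE)
  show thesis using G_nz ST r by (intro that[of r S T]) auto
qed

text \<open>
  The Nullstellensatz for principal prime ideals, as a property of a set of complex-valued points
  of a ring: a function that vanishes on the zero set of a prime element is divisible by it.
  The clause on nonzero elements serves to keep leading coefficients from vanishing.
\<close>
definition separating_points :: "('a::comm_ring_1 \<Rightarrow> complex) set \<Rightarrow> bool" where
  "separating_points E \<longleftrightarrow>
     (\<forall>e\<in>E. comm_ring_hom e) \<and>
     (\<forall>r. r \<noteq> 0 \<longrightarrow> (\<exists>e\<in>E. e r \<noteq> 0)) \<and>
     (\<forall>Q H. prime_elem Q \<longrightarrow> \<not> Q dvd H \<longrightarrow> (\<exists>e\<in>E. e Q = 0 \<and> e H \<noteq> 0))"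

lemma separating_points_complex: "separating_points {\<lambda>c. c}"
  unfolding separating_points_def
  by (auto simp: prime_elem_def dvd_field_iff intro!: comm_ring_hom.intro)

lemma poly_nonzero_value:
  fixes f :: "complex poly"
  assumes "f \<noteq> 0"
  obtains v where "poly f v \<noteq> 0"
  using assms poly_all_0_iff_0 by blast

text \<open>
  One more variable. A prime \<open>Q\<close> which is constant in the new variable is handled by a coefficient
  of \<open>H\<close> that it does not divide. Otherwise the eliminant \<open>r\<close> of \<open>Q\<close> and \<open>H\<close> does not involve the
  new variable; over a point where \<open>r\<close> and the leading coefficient of \<open>Q\<close> are nonzero, \<open>Q\<close> has a
  root, and \<open>H\<close> cannot vanish at it because \<open>r\<close> does not.
\<close>
lemma separating_points_extend_hom:
  fixes E :: "('a::idom \<Rightarrow> complex) set"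
  assumes "separating_points E"
  shows "separating_points {extend_hom e v |e v. e \<in> E}"
proof -
  have hom: "comm_ring_hom e" if "e \<in> E" for e
    using assms that by (simp add: separating_points_def)
  have nz: "\<exists>e\<in>E. e r \<noteq> 0" if "r \<noteq> 0" for r
    using assms that by (simp add: separating_points_def)
  have coeff_e: "coeff (map_poly e p) i = e (coeff p i)" if "e \<in> E" for e p i
    using comm_ring_hom.hom_zero[OF hom[OF that]] by (simp add: coeff_map_poly)
  have nonroot: "\<exists>v. extend_hom e v p \<noteq> 0" if "e \<in> E" "e (coeff p i) \<noteq> 0" for e p i
  proof -
    have "map_poly e p \<noteq> 0" using that coeff_e by (metis coeff_0)
    thus ?thesis by (metis poly_nonzero_value extend_hom_def)
  qed
  have "\<exists>e v. e \<in> E \<and> extend_hom e v Q = 0 \<and> extend_hom e v H \<noteq> 0"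
    if Q: "prime_elem Q" and QH: "\<not> Q dvd H" for Q H
  proof (cases "degree Q = 0")
    case True
    then obtain c where c: "Q = [:c:]" by (rule degree_eq_zeroE)
    obtain i where i: "\<not> c dvd coeff H i" using QH c by (auto simp: const_poly_dvd_iff)
    have "prime_elem c" using Q c by (simp add: prime_elem_const_poly_iff)
    with assms i obtain e where e: "e \<in> E" "e c = 0" "e (coeff H i) \<noteq> 0"
      unfolding separating_points_def by meson
    interpret comm_ring_hom e by (rule hom) fact
    have "extend_hom e v Q = 0" for v using e c by simp
    with nonroot e show ?thesis by blast
  next
    case False
    then obtain S T r where r: "r \<noteq> 0" "S * Q + T * H = [:r:]"
      using prime_elem_eliminant[OF Q _ QH] by blast
    from False have "lead_coeff Q \<noteq> 0" by auto
    with r(1) obtain e where e: "e \<in> E" "e (lead_coeff Q * r) \<noteq> 0" using nz by (metis mult_eq_0_iff)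
    interpret comm_ring_hom e by (rule hom) fact
    have "coeff (map_poly e Q) (degree Q) \<noteq> 0" using e coeff_e by auto
    hence "degree (map_poly e Q) > 0" using False le_degree by (metis le_zero_eq neq0_conv)
    hence "\<not> constant (poly (map_poly e Q))" by (simp add: constant_degree)
    then obtain v where v: "extend_hom e v Q = 0"
      using fundamental_theorem_of_algebra by (auto simp: extend_hom_def)
    have "extend_hom e v T * extend_hom e v H = e r"
      using arg_cong[OF r(2), of "extend_hom e v"] v by (simp add: extend_hom_add extend_hom_mult)
    hence "extend_hom e v H \<noteq> 0" using e by auto
    thus ?thesis using e v by blast
  qed
  moreover have "\<exists>e v. e \<in> E \<and> extend_hom e v p \<noteq> 0" if "p \<noteq> 0" for p
    using nz[of "lead_coeff p"] nonroot that by fastforce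
  moreover have "comm_ring_hom (extend_hom e v)" if "e \<in> E" for e v
    using comm_ring_hom.comm_ring_hom_extend_hom[OF hom[OF that]] .
  ultimately show ?thesis
    unfolding separating_points_def by (simp only: mem_Collect_eq Bex_def Ball_def) metis
qed

text \<open>
  The evaluation substitutes constants for the outer variables first; equivalently, one starts with
  the innermost variable and extends the homomorphism outwards.
\<close>
lemma heval_eq_extend_hom:
  "heval H (u, v) (w, z) =
     extend_hom (extend_hom (extend_hom (extend_hom (\<lambda>c. c) w) u) z) v H"
proof -
  have h0: "comm_ring_hom (\<lambda>c::complex. c)" by unfold_locales simp_all
  note h1 = comm_ring_hom.comm_ring_hom_extend_hom[OF h0, of w]
  note h2 = comm_ring_hom.comm_ring_hom_extend_hom[OF h1, of u]
  note h3 = comm_ring_hom.comm_ring_hom_extend_hom[OF h2, of z]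
  have "heval H (u, v) (w, z) = extend_hom (\<lambda>c. c) w
      (poly (poly (poly H [:[:[:v:]:]:]) [:[:z:]:]) [:u:])"
    by (simp add: heval_def extend_hom_def map_poly_idI)
  then show ?thesis
    by (simp add: h0 h1 h2 h3 comm_ring_hom.hom_poly_eq_extend_hom
          comm_ring_hom.extend_hom_pCons comm_ring_hom.extend_hom_0)
qed

text \<open>The Nullstellensatz for hypersurfaces in the four-space of the homogeneous coordinates.\<close>
lemma separating_points_heval:
  "separating_points {\<lambda>H. heval H (u, v) (w, z) |u v w z. True}"
proof -
  have "separating_points {extend_hom e v |e v. e \<in> {extend_hom e z |e z. e \<in>
     {extend_hom e u |e u. e \<in> {extend_hom e w |e w. e \<in> {\<lambda>c. c}}}}}"
    by (intro separating_points_extend_hom separating_points_complex)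
  also have "{extend_hom e v |e v. e \<in> {extend_hom e z |e z. e \<in>
     {extend_hom e u |e u. e \<in> {extend_hom e w |e w. e \<in> {\<lambda>c. c}}}}} =
     {\<lambda>H. heval H (u, v) (w, z) |u v w z. True}"
    unfolding heval_eq_extend_hom by blast
  finally show ?thesis .
qed

lemma comm_ring_hom_heval: "comm_ring_hom (\<lambda>H. heval H p q)"
  by (cases p; cases q) (auto simp: heval_def intro!: comm_ring_hom.intro)

lemma heval_hconst: "heval (hconst c) p q = c"
  by (cases p; cases q) (simp add: heval_def hconst_def)

section \<open>Gradings and factors of bihomogeneous polynomials\<close>

text \<open>
  A grading is encoded by the homomorphism that multiplies the elements of degree \<open>k\<close> by \<open>t ^ k\<close>,
  where \<open>t\<close> is a new variable: \<open>F\<close> is homogeneous of degree \<open>n\<close> iff \<open>\<sigma> F = monom F n\<close>. Products of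
  homogeneous elements thereby turn into products of monomials in \<open>t\<close>, whose factors are monomials.
\<close>
definition grading :: "('a::comm_ring_1 \<Rightarrow> 'a poly) \<Rightarrow> bool" where
  "grading \<sigma> \<longleftrightarrow> comm_ring_hom \<sigma> \<and> (\<forall>f. poly (\<sigma> f) 1 = f)"

lemma order_eq_degree_imp_monom:
  fixes f :: "'a::idom poly"
  assumes "f \<noteq> 0" "order 0 f = degree f"
  obtains c where "f = monom c (degree f)"
proof -
  have "[:- 0, 1:] ^ degree f dvd f" using assms order_divides[of 0 "degree f" f] by simp
  then obtain g where g: "f = monom 1 (degree f) * g" by (auto simp: monom_altdef elim!: dvdE)
  hence "g \<noteq> 0" using assms(1) by auto
  have "degree f = degree f + degree g"
    using arg_cong[OF g, of degree] \<open>g \<noteq> 0\<close> by (simp add: degree_mult_eq degree_monom_eq)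
  then obtain c where "g = [:c:]" by (metis add_cancel_left_right degree_eq_zeroE)
  thus thesis using g by (intro that[of c]) (simp add: mult.commute smult_monom)
qed

text \<open>
  The order at 0 and the degree are both additive, the order is at most the degree, and for a
  monomial they agree; hence they agree for every factor.
\<close>
lemma monom_factor_is_monom:
  fixes f g :: "'a::idom poly"
  assumes "f * g = monom c n" "c \<noteq> 0"
  obtains d k where "f = monom d k"
proof -
  have nz: "f * g \<noteq> 0" using assms by (simp add: monom_eq_0_iff)
  hence "f \<noteq> 0" "g \<noteq> 0" by auto
  have "order 0 (f * g) = n"
  proof (rule order_unique_lemma)
    show "[:- 0, 1:] ^ n dvd f * g"
      using assms by (simp add: monom_altdef dvd_smult)
    show "\<not> [:- 0, 1:] ^ Suc n dvd f * g"
    proof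
      assume "[:- 0, 1:] ^ Suc n dvd f * g"
      hence "degree ([:- 0, 1::'a:] ^ Suc n) \<le> degree (f * g)"
        using nz by (rule dvd_imp_degree_le)
      thus False using assms by (simp add: degree_monom_eq degree_power_eq del: power_Suc)
    qed
  qed
  hence "order 0 f + order 0 g = degree f + degree g"
    using order_mult[OF nz, of 0] assms \<open>f \<noteq> 0\<close> \<open>g \<noteq> 0\<close>
    by (metis degree_monom_eq degree_mult_eq)
  moreover have "order 0 f \<le> degree f" "order 0 g \<le> degree g"
    using \<open>f \<noteq> 0\<close> \<open>g \<noteq> 0\<close> by (simp_all add: order_degree)
  ultimately have "order 0 f = degree f" by simp
  with \<open>f \<noteq> 0\<close> show thesis using order_eq_degree_imp_monom that by blast
qed

text \<open>
  As \<open>\<sigma> F\<close> divides a monomial in \<open>t\<close>, it is a monomial, and setting \<open>t = 1\<close> identifies its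
  coefficient as \<open>F\<close>. So factors of homogeneous elements are homogeneous.
\<close>
lemma graded_factor:
  fixes F G :: "'a::idom"
  assumes "grading \<sigma>" "F * G \<noteq> 0" "\<sigma> (F * G) = monom (F * G) n"
  obtains k where "\<sigma> F = monom F k"
proof -
  interpret comm_ring_hom \<sigma> using assms(1) by (simp add: grading_def)
  have "\<sigma> F * \<sigma> G = monom (F * G) n" using assms(3) by simp
  then obtain d k where dk: "\<sigma> F = monom d k" using assms(2) by (rule monom_factor_is_monom)
  have "F = poly (\<sigma> F) 1" using assms(1) by (simp add: grading_def)
  hence "d = F" using dk by (simp add: poly_monom)
  with dk that show thesis by blast
qed

text \<open>The inclusion of \<open>R[t]\<close> in \<open>R[X][t]\<close>; in the nested representation \<open>t\<close> is the outer variable.\<close>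
definition lift_coeffs :: "'a::comm_ring_1 poly \<Rightarrow> 'a poly poly" where
  "lift_coeffs = extend_hom (\<lambda>c. [:[:c:]:]) [:0, 1:]"

lemma comm_ring_hom_double_const: "comm_ring_hom (\<lambda>c::'a::comm_ring_1. [:[:c:]:])"
  by unfold_locales (simp_all add: one_pCons)

lemma lift_coeffs_0 [simp]: "lift_coeffs 0 = 0"
  unfolding lift_coeffs_def by (rule comm_ring_hom.extend_hom_0[OF comm_ring_hom_double_const])

lemma lift_coeffs_pCons [simp]:
  "lift_coeffs (pCons a p) = pCons [:a:] (lift_coeffs p)"
  unfolding lift_coeffs_def
  by (simp add: comm_ring_hom.extend_hom_pCons[OF comm_ring_hom_double_const])

lemma comm_ring_hom_lift_coeffs: "comm_ring_hom lift_coeffs"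
  unfolding lift_coeffs_def
  by (rule comm_ring_hom.comm_ring_hom_extend_hom[OF comm_ring_hom_double_const])

lemma coeff_lift_coeffs: "coeff (lift_coeffs p) n = [:coeff p n:]"
  by (induction p arbitrary: n) (auto simp: coeff_pCons split: nat.splits)

lemma poly_lift_coeffs: "poly (lift_coeffs p) 1 = [:poly p 1:]"
  by (induction p) (simp_all add: one_pCons)

text \<open>The grading of \<open>R[X]\<close> that extends \<open>\<sigma>\<close> and gives \<open>X\<close> the degree \<open>d\<close>.\<close>
definition extend_grading :: "nat \<Rightarrow> ('a::comm_ring_1 \<Rightarrow> 'a poly) \<Rightarrow> 'a poly \<Rightarrow> 'a poly poly" where
  "extend_grading d \<sigma> = extend_hom (\<lambda>f. lift_coeffs (\<sigma> f)) (monom [:0, 1:] d)"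

lemma extend_grading_pCons:
  assumes "comm_ring_hom \<sigma>"
  shows "extend_grading d \<sigma> (pCons a p) =
    lift_coeffs (\<sigma> a) + monom [:0, 1:] d * extend_grading d \<sigma> p"
  unfolding extend_grading_def
  by (rule comm_ring_hom.extend_hom_pCons)
     (rule comm_ring_hom_compose[OF comm_ring_hom_lift_coeffs assms])

lemma extend_grading_0: "extend_grading d \<sigma> 0 = 0"
  by (simp add: extend_grading_def extend_hom_def)

lemma grading_extend_grading:
  assumes "grading \<sigma>"
  shows "grading (extend_grading d \<sigma>)"
proof -
  have hom: "comm_ring_hom \<sigma>" using assms by (simp add: grading_def)
  have "comm_ring_hom (extend_grading d \<sigma>)"
    unfolding extend_grading_def
    by (intro comm_ring_hom.comm_ring_hom_extend_hom comm_ring_hom_compose[OF comm_ring_hom_lift_coeffs hom])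
  moreover have "poly (extend_grading d \<sigma> p) 1 = p" for p
    by (induction p)
       (use assms in \<open>simp_all add: extend_grading_0 extend_grading_pCons[OF hom]
          poly_lift_coeffs poly_monom grading_def\<close>)
  ultimately show ?thesis by (simp add: grading_def)
qed

lemma coeff_extend_grading:
  assumes "comm_ring_hom \<sigma>"
  shows "coeff (coeff (extend_grading d \<sigma> p) n) i = coeff (monom 1 (d * i) * \<sigma> (coeff p i)) n"
proof (induction p arbitrary: n i)
  case 0
  then show ?case using comm_ring_hom.hom_zero[OF assms] by (simp add: extend_grading_0)
next
  case (pCons a p)
  then show ?case
    by (cases i)
       (auto simp: extend_grading_pCons[OF assms] coeff_monom_mult coeff_lift_coeffs)
qed

text \<open>
  Reduces homogeneity over \<open>R[X]\<close> to homogeneity over \<open>R\<close>. The shift \<open>e\<close> collects the contribution of the variables already treated when the equivalence is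
  applied to several variables in succession.
\<close>
lemma extend_grading_eq_monom_iff:
  assumes "comm_ring_hom \<sigma>"
  shows "monom 1 e * extend_grading d \<sigma> p = monom p n \<longleftrightarrow>
    (\<forall>i. monom 1 (e + d * i) * \<sigma> (coeff p i) = monom (coeff p i) n)"
proof -
  have "coeff (coeff (monom 1 e * extend_grading d \<sigma> p) k) i =
      coeff (monom 1 (e + d * i) * \<sigma> (coeff p i)) k" for k i
    by (auto simp: coeff_monom_mult coeff_extend_grading[OF assms])
  moreover have "coeff (coeff (monom p n) k) i = coeff (monom (coeff p i) n) k" for k i
    by simp
  ultimately show ?thesis by (auto simp: poly_eq_iff simp del: coeff_monom)
qed

lemma extend_hom_lift_coeffs:
  assumes "comm_ring_hom e"
  shows "extend_hom (extend_hom e v) t (lift_coeffs p) = extend_hom e t p"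
proof -
  note e' = comm_ring_hom.comm_ring_hom_extend_hom[OF assms, of v]
  show ?thesis
    by (induction p) (simp_all add: comm_ring_hom.extend_hom_0[OF assms]
        comm_ring_hom.extend_hom_0[OF e'] comm_ring_hom.extend_hom_pCons[OF assms]
        comm_ring_hom.extend_hom_pCons[OF e'])
qed

lemma extend_hom_monom:
  assumes "comm_ring_hom e"
  shows "extend_hom e t (monom c n) = e c * t ^ n"
  by (induction n) (simp_all add: monom_0 monom_Suc comm_ring_hom.extend_hom_0[OF assms]
      comm_ring_hom.extend_hom_pCons[OF assms] comm_ring_hom.hom_zero[OF assms])

text \<open>
  Giving \<open>t\<close> a value in the grading amounts to rescaling the point: if \<open>e'\<close> is the rescaled point
  for \<open>R\<close>, then the new coordinate \<open>v\<close> is rescaled to \<open>t ^ d * v\<close>.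
\<close>
lemma extend_hom_extend_grading:
  assumes \<sigma>: "comm_ring_hom \<sigma>" and e: "comm_ring_hom e" and e': "comm_ring_hom e'"
    and eq: "\<And>f. extend_hom e t (\<sigma> f) = e' f"
  shows "extend_hom (extend_hom e v) t (extend_grading d \<sigma> p) = extend_hom e' (t ^ d * v) p"
proof -
  note ev = comm_ring_hom.comm_ring_hom_extend_hom[OF e, of v]
  show ?thesis
    by (induction p) (simp_all add: extend_grading_0 extend_grading_pCons[OF \<sigma>] extend_hom_lift_coeffs[OF e]
        extend_hom_monom[OF ev] eq comm_ring_hom.extend_hom_0[OF ev] comm_ring_hom.extend_hom_0[OF e']
        comm_ring_hom.extend_hom_add[OF ev] comm_ring_hom.extend_hom_mult[OF ev]
        comm_ring_hom.extend_hom_pCons[OF e] comm_ring_hom.extend_hom_pCons[OF e']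
        comm_ring_hom.extend_hom_0[OF e]
        comm_ring_hom.hom_zero[OF e] comm_ring_hom.hom_one[OF e])
qed

text \<open>
  The grading in which \<open>X0\<close>, \<open>X1\<close> have degree \<open>d\<close> and \<open>Y0\<close>, \<open>Y1\<close> have degree \<open>e\<close>. The two degrees of
  a bihomogeneous polynomial are those for \<open>(d, e) = (1, 0)\<close> and \<open>(0, 1)\<close>.
\<close>
definition bigrading :: "nat \<Rightarrow> nat \<Rightarrow> hpoly \<Rightarrow> hpoly poly" where
  "bigrading d e = extend_grading d (extend_grading e (extend_grading d (extend_grading e (\<lambda>c. [:c:]))))"

lemma grading_const: "grading (\<lambda>c::complex. [:c:])"
  by (simp add: grading_def comm_ring_hom_def one_pCons)

lemma grading_bigrading: "grading (bigrading d e)"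
  unfolding bigrading_def by (intro grading_extend_grading grading_const)

lemma bigrading_eq_monom_iff:
  "bigrading d e H = monom H n \<longleftrightarrow>
    (\<forall>i j k l. coeff (coeff (coeff (coeff H i) j) k) l \<noteq> 0 \<longrightarrow> d * i + e * j + d * k + e * l = n)"
proof -
  define g0 where "g0 = (\<lambda>c::complex. [:c:])"
  have g0: "grading g0" by (simp add: g0_def grading_const)
  note g1 = grading_extend_grading[OF g0, of e]
  note g2 = grading_extend_grading[OF g1, of d]
  note g3 = grading_extend_grading[OF g2, of e]
  have h: "comm_ring_hom \<sigma>" if "grading \<sigma>" for \<sigma> :: "'b::comm_ring_1 \<Rightarrow> 'b poly"
    using that by (simp add: grading_def)
  have base: "monom 1 m * g0 c = monom c n \<longleftrightarrow> (c \<noteq> 0 \<longrightarrow> m = n)" for m c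
    by (auto simp: g0_def smult_monom monom_eq_iff' mult.commute[of "monom 1 m"])
  have "bigrading d e H = monom H n \<longleftrightarrow> monom 1 0 * bigrading d e H = monom H n"
    by (simp add: monom_0 one_pCons[symmetric])
  also have "\<dots> \<longleftrightarrow>
    (\<forall>i j k l. coeff (coeff (coeff (coeff H i) j) k) l \<noteq> 0 \<longrightarrow> 0 + d * i + e * j + d * k + e * l = n)"
    unfolding bigrading_def g0_def[symmetric]
    by (simp only: extend_grading_eq_monom_iff h[OF g0] h[OF g1] h[OF g2] h[OF g3] base)
  finally show ?thesis by simp
qed

lemma bihomogeneous_of_iff:
  "bihomogeneous_of a b H \<longleftrightarrow> bigrading 1 0 H = monom H a \<and> bigrading 0 1 H = monom H b"
  unfolding bihomogeneous_of_def bigrading_eq_monom_iff by auto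

lemma bihomogeneous_factor:
  assumes "bihomogeneous H" "H \<noteq> 0" "F dvd H"
  shows "bihomogeneous F"
proof -
  obtain G where G: "H = F * G" using assms(3) by blast
  obtain a b where "bigrading 1 0 H = monom H a" "bigrading 0 1 H = monom H b"
    using assms(1) by (auto simp: bihomogeneous_def bihomogeneous_of_iff)
  then obtain a' b' where "bigrading 1 0 F = monom F a'" "bigrading 0 1 F = monom F b'"
    using graded_factor[OF grading_bigrading] assms(2) G by metis
  thus ?thesis by (auto simp: bihomogeneous_def bihomogeneous_of_iff)
qed

lemma heval_bigrading:
  "extend_hom (\<lambda>H. heval H (u, v) (w, z)) t (bigrading d e H) =
     heval H (t ^ d * u, t ^ d * v) (t ^ e * w, t ^ e * z)"
proof -
  define e0 where "e0 = (\<lambda>c::complex. c)"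
  define g0 where "g0 = (\<lambda>c::complex. [:c:])"
  have e0: "comm_ring_hom e0" by (simp add: e0_def comm_ring_hom_def)
  have g0: "grading g0" by (simp add: g0_def grading_const)
  note hom_ext = comm_ring_hom.comm_ring_hom_extend_hom
  note g1 = grading_extend_grading[OF g0, of e]
  note g2 = grading_extend_grading[OF g1, of d]
  note g3 = grading_extend_grading[OF g2, of e]
  have h: "comm_ring_hom \<sigma>" if "grading \<sigma>" for \<sigma> :: "'b::comm_ring_1 \<Rightarrow> 'b poly"
    using that by (simp add: grading_def)
  have "extend_hom e0 t (g0 f) = e0 f" for f
    by (simp add: g0_def e0_def extend_hom_def map_poly_idI)
  note s1 = extend_hom_extend_grading[OF h[OF g0] e0 e0 this, of w e]
  note s2 = extend_hom_extend_grading[OF h[OF g1] hom_ext[OF e0] hom_ext[OF e0] s1, of u d]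
  note s3 = extend_hom_extend_grading[OF h[OF g2] hom_ext[OF hom_ext[OF e0]] hom_ext[OF hom_ext[OF e0]] s2, of z e]
  note s4 = extend_hom_extend_grading[OF h[OF g3] hom_ext[OF hom_ext[OF hom_ext[OF e0]]]
    hom_ext[OF hom_ext[OF hom_ext[OF e0]]] s3, of v d]
  show ?thesis
    using s4[of H] unfolding bigrading_def heval_eq_extend_hom e0_def g0_def .
qed

lemma heval_scale:
  assumes "bihomogeneous_of a b H"
  shows "heval H (t * u, t * v) (s * w, s * z) = t ^ a * s ^ b * heval H (u, v) (w, z)"
proof -
  have hom: "comm_ring_hom (\<lambda>H. heval H (u, v) (w, z))" for u v w z
    by (rule comm_ring_hom_heval)
  have "heval H (t * u, t * v) (s * w, s * z) =
      extend_hom (\<lambda>H. heval H (u, v) (s * w, s * z)) t (bigrading 1 0 H)"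
    by (simp add: heval_bigrading)
  also have "\<dots> = heval H (u, v) (s * w, s * z) * t ^ a"
    using assms by (simp add: bihomogeneous_of_iff extend_hom_monom[OF hom])
  also have "heval H (u, v) (s * w, s * z) =
      extend_hom (\<lambda>H. heval H (u, v) (w, z)) s (bigrading 0 1 H)"
    by (simp add: heval_bigrading)
  also have "\<dots> = heval H (u, v) (w, z) * s ^ b"
    using assms by (simp add: bihomogeneous_of_iff extend_hom_monom[OF hom])
  finally show ?thesis by simp
qed

section \<open>The Nullstellensatz on the product of projective lines\<close>

lemma homogeneous_coordinates:
  assumes "(u, v) \<noteq> (0, 0)"
  obtains t p where "t \<noteq> 0" "(u, v) = (t * fst (hcoords p), t * snd (hcoords p))"
proof (cases "v = 0")
  case True
  thus thesis using assms by (intro that[of u Infty]) auto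
next
  case False
  thus thesis by (intro that[of v "Fin (u / v)"]) auto
qed

lemma value_at_homogeneous_coordinates:
  assumes "(u, v) \<noteq> (0, 0)" "(w, z) \<noteq> (0, 0)"
  obtains q where "\<And>H. bihomogeneous H \<Longrightarrow> heval H (u, v) (w, z) = 0 \<longleftrightarrow> value_at H q = 0"
proof -
  obtain t p where p: "t \<noteq> 0" "(u, v) = (t * fst (hcoords p), t * snd (hcoords p))"
    using homogeneous_coordinates[OF assms(1)] by blast
  obtain s p' where p': "s \<noteq> 0" "(w, z) = (s * fst (hcoords p'), s * snd (hcoords p'))"
    using homogeneous_coordinates[OF assms(2)] by blast
  show thesis
  proof (rule that[of "(p, p')"])
    fix H assume "bihomogeneous H"
    then obtain a b where "bihomogeneous_of a b H" by (auto simp: bihomogeneous_def)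
    thus "heval H (u, v) (w, z) = 0 \<longleftrightarrow> value_at H (p, p') = 0"
      unfolding p(2) p'(2) by (simp add: heval_scale value_at_def p(1) p'(1))
  qed
qed

definition X0 :: hpoly where "X0 = [:[:[:0, 1:]:]:]"
definition X1 :: hpoly where "X1 = [:0, 1:]"
definition Y0 :: hpoly where "Y0 = [:[:[:[:0, 1:]:]:]:]"
definition Y1 :: hpoly where "Y1 = [:[:0, 1:]:]"

lemma heval_coordinates:
  "heval X0 (u, v) (w, z) = u" "heval X1 (u, v) (w, z) = v"
  "heval Y0 (u, v) (w, z) = w" "heval Y1 (u, v) (w, z) = z"
  by (simp_all add: heval_def X0_def X1_def Y0_def Y1_def)

lemma dvd_variable_and_const_imp_unit:
  fixes Q :: "'a::idom poly"
  assumes "Q dvd [:0, 1:]" "Q dvd [:c:]" "c \<noteq> 0"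
  shows "Q dvd 1"
proof -
  have "degree Q \<le> degree [:c:]" using assms by (intro dvd_imp_degree_le) auto
  then obtain q where q: "Q = [:q:]" by (metis degree_pCons_0 le_zero_eq degree_eq_zeroE)
  hence "q dvd coeff [:0, 1:] 1" using assms(1) const_poly_dvd_iff[of q "[:0, 1:]"] by blast
  hence "q dvd 1" by simp
  thus ?thesis using q by (simp add: is_unit_const_poly_iff)
qed

lemma prime_elem_not_dvd_coordinates:
  assumes "prime_elem Q"
  shows "\<not> Q dvd X0 \<or> \<not> Q dvd X1" "\<not> Q dvd Y0 \<or> \<not> Q dvd Y1"
proof -
  have nu: "\<not> Q dvd 1" using assms by auto
  show "\<not> Q dvd X0 \<or> \<not> Q dvd X1"
    using nu dvd_variable_and_const_imp_unit[of Q "[:[:0, 1:]:]"] unfolding X0_def X1_def by auto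
  show "\<not> Q dvd Y0 \<or> \<not> Q dvd Y1"
  proof (rule ccontr)
    assume "\<not> ?thesis"
    hence d: "Q dvd [:[:[:[:0, 1:]:]:]:]" "Q dvd [:[:0, 1:]:]" by (auto simp: Y0_def Y1_def)
    hence "degree Q \<le> degree [:[:0, 1 :: complex poly poly:]:]" by (intro dvd_imp_degree_le) auto
    hence "degree Q = 0" by simp
    then obtain q where q: "Q = [:q:]" by (rule degree_eq_zeroE)
    have "q dvd 1" using d unfolding q const_poly_dvd_const_poly_iff
      by (intro dvd_variable_and_const_imp_unit) auto
    thus False using nu q by (simp add: is_unit_const_poly_iff)
  qed
qed

text \<open>
  The affine Nullstellensatz yields a zero of \<open>Q\<close> in four-space at which \<open>H\<close> does not vanish; it
  represents a point of the product of projective lines only if neither pair of coordinates is zero.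
  To ensure this, \<open>H\<close> is multiplied by one coordinate of each pair that \<open>Q\<close> does not divide.
\<close>
lemma prime_elem_dvd_if_zero_locus_subset:
  assumes "prime_elem Q" "bihomogeneous Q" "bihomogeneous H" "zero_locus Q \<subseteq> zero_locus H"
  shows "Q dvd H"
proof (rule ccontr)
  assume "\<not> Q dvd H"
  obtain A where A: "A \<in> {X0, X1}" "\<not> Q dvd A"
    using prime_elem_not_dvd_coordinates(1)[OF assms(1)] by auto
  obtain B where B: "B \<in> {Y0, Y1}" "\<not> Q dvd B"
    using prime_elem_not_dvd_coordinates(2)[OF assms(1)] by auto
  have "\<not> Q dvd H * A * B"
    using \<open>\<not> Q dvd H\<close> A B assms(1) by (simp add: prime_elem_dvd_mult_iff)
  then obtain u v w z where pt: "heval Q (u, v) (w, z) = 0" "heval (H * A * B) (u, v) (w, z) \<noteq> 0"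
    using separating_points_heval assms(1) unfolding separating_points_def by blast
  hence nz: "heval H (u, v) (w, z) \<noteq> 0" "heval A (u, v) (w, z) \<noteq> 0" "heval B (u, v) (w, z) \<noteq> 0"
    by (auto simp: comm_ring_hom.hom_mult[OF comm_ring_hom_heval])
  hence "(u, v) \<noteq> (0, 0)" "(w, z) \<noteq> (0, 0)"
    using A(1) B(1) by (auto simp: heval_coordinates)
  then obtain q where "\<And>H. bihomogeneous H \<Longrightarrow> heval H (u, v) (w, z) = 0 \<longleftrightarrow> value_at H q = 0"
    using value_at_homogeneous_coordinates by blast
  hence "value_at Q q = 0" "value_at H q \<noteq> 0" using pt nz assms by auto
  thus False using assms(4) by (auto simp: zero_locus_def)
qed

section \<open>Divisors determine bihomogeneous polynomials up to constants\<close>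

lemma comm_ring_hom_value_at: "comm_ring_hom (\<lambda>H. value_at H q)"
  unfolding value_at_def by (rule comm_ring_hom_heval)

lemma value_at_hconst: "value_at (hconst c) q = c"
  unfolding value_at_def by (rule heval_hconst)

lemma zero_locus_mono: "F dvd G \<Longrightarrow> zero_locus F \<subseteq> zero_locus G"
  by (auto simp: zero_locus_def comm_ring_hom.hom_mult[OF comm_ring_hom_value_at] elim!: dvdE)

lemma value_at_unit_nonzero: "F dvd 1 \<Longrightarrow> value_at F q \<noteq> 0"
  using comm_ring_hom.hom_dvd[OF comm_ring_hom_value_at, of F 1 q]
  by (auto simp: comm_ring_hom.hom_one[OF comm_ring_hom_value_at])

lemma is_unit_hpolyE:
  fixes F :: hpoly
  assumes "F dvd 1"
  obtains c where "c \<noteq> 0" "F = hconst c"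
  using assms by (auto simp: is_unit_poly_iff hconst_def dvd_field_iff)

lemma hconst_dvd_one: "c \<noteq> 0 \<Longrightarrow> hconst c dvd 1"
  by (simp add: hconst_def is_unit_const_poly_iff dvd_field_iff)

lemma zero_locus_eq_iff_dvd:
  assumes "irreducible P" "bihomogeneous P" "irreducible Q" "bihomogeneous Q"
  shows "zero_locus P = zero_locus Q \<longleftrightarrow> P dvd Q"
proof
  assume "zero_locus P = zero_locus Q"
  thus "P dvd Q"
    using assms by (intro prime_elem_dvd_if_zero_locus_subset irreducible_imp_prime_elem) auto
next
  assume "P dvd Q"
  moreover from this have "Q dvd P"
    using assms(1,3) irreducibleD' irreducible_not_unit by blast
  ultimately show "zero_locus P = zero_locus Q" by (simp add: zero_locus_mono subset_antisym)
qed

text \<open>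
  The choice made in \<open>defining_poly\<close> is immaterial, since irreducible polynomials with the same zero
  locus divide each other.
\<close>
lemma zero_divisor_zero_locus:
  assumes "irreducible P" "bihomogeneous P"
  shows "zero_divisor H (zero_locus P) = multiplicity P H"
proof -
  define Q where "Q = defining_poly (zero_locus P)"
  have "\<exists>Q. irreducible Q \<and> bihomogeneous Q \<and> zero_locus Q = zero_locus P"
    using assms by blast
  hence Q: "irreducible Q \<and> bihomogeneous Q \<and> zero_locus Q = zero_locus P"
    unfolding Q_def defining_poly_def by (rule someI_ex)
  hence "Q dvd P" "P dvd Q"
    using assms zero_locus_eq_iff_dvd by auto
  hence "normalize Q = normalize P" by (rule associatedI)
  hence "multiplicity Q H = multiplicity P H" by (metis multiplicity_normalize_left)
  thus ?thesis using assms by (auto simp: zero_divisor_def prime_divisor_def Q_def)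
qed

text \<open>
  Unique factorization: \<open>H\<close> and the product have the same multiplicity at every prime. At a
  bihomogeneous prime \<open>p\<close> both are the coefficient of the divisor at the zero locus of \<open>p\<close>; any
  other prime divides neither, because factors of bihomogeneous polynomials are bihomogeneous.
\<close>
lemma prime_decomposition_zero_divisorD:
  assumes "prime_decomposition (zero_divisor H) n m P" "H \<noteq> 0" "bihomogeneous H"
  obtains c where "c \<noteq> 0" "H = hconst c * prime_prod n m P"
proof -
  have P: "irreducible (P j)" "bihomogeneous (P j)" if "j \<in> {1..n}" for j
    using assms(1) that by (auto simp: prime_decomposition_def)
  have E: "zero_divisor H D = (\<Sum>j=1..n. m j * divisor_of_prime (zero_locus (P j)) D)" for D
    using assms(1) by (simp add: prime_decomposition_def fun_eq_iff)
  have nz: "P j \<noteq> 0" if "j \<in> {1..n}" for j using P(1)[OF that] by auto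
  have "normalize H = normalize (prime_prod n m P)"
  proof (rule multiplicity_eq_imp_eq)
    show "H \<noteq> 0" by fact
    show "prime_prod n m P \<noteq> 0" using nz by (simp add: prime_prod_def)
    fix p :: hpoly assume "prime p"
    hence p: "prime_elem p" "irreducible p" by (auto intro: prime_elem_imp_irreducible)
    have "multiplicity p (prime_prod n m P) = (\<Sum>j=1..n. multiplicity p (P j ^ m j))"
      unfolding prime_prod_def using nz p by (subst prime_elem_multiplicity_prod_distrib) auto
    also have "\<dots> = (\<Sum>j=1..n. m j * multiplicity p (P j))"
      using nz p by (intro sum.cong) (auto simp: prime_elem_multiplicity_power_distrib)
    finally have prod: "multiplicity p (prime_prod n m P) = (\<Sum>j=1..n. m j * multiplicity p (P j))" .
    show "multiplicity p H = multiplicity p (prime_prod n m P)"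
    proof (cases "bihomogeneous p")
      case True
      have "multiplicity p (P j) = divisor_of_prime (zero_locus (P j)) (zero_locus p)"
        if j: "j \<in> {1..n}" for j
      proof (cases "p dvd P j")
        case d: True
        hence "P j dvd p" using P(1)[OF j] p(2) irreducibleD' irreducible_not_unit by blast
        with d have "normalize (P j) = normalize p" by (intro associatedI)
        hence "multiplicity p (P j) = multiplicity p p" by (metis multiplicity_normalize_right)
        also have "\<dots> = 1" using p by simp
        finally show ?thesis
          using d zero_locus_eq_iff_dvd[OF p(2) True P[OF j]] by (simp add: divisor_of_prime_def)
      next
        case False
        thus ?thesis
          using zero_locus_eq_iff_dvd[OF p(2) True P[OF j]]
          by (simp add: divisor_of_prime_def not_dvd_imp_multiplicity_0)
      qed
      with prod zero_divisor_zero_locus[OF p(2) True, of H] E[of "zero_locus p"]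
      show ?thesis by simp
    next
      case False
      have "\<not> p dvd H" using assms False bihomogeneous_factor by blast
      moreover have "multiplicity p (P j) = 0" if "j \<in> {1..n}" for j
        using P(2)[OF that] nz[OF that] False bihomogeneous_factor not_dvd_imp_multiplicity_0 by blast
      ultimately show ?thesis using prod by (simp add: not_dvd_imp_multiplicity_0)
    qed
  qed
  then obtain u where u: "u dvd 1" "H = u * prime_prod n m P"
    by (metis associated_iff_dvd dvdE mult.commute associatedE1)
  thus thesis using is_unit_hpolyE that by metis
qed

lemma vanishing_prime_factor:
  assumes "H \<noteq> 0" "value_at H q = 0"
  shows "\<exists>P. prime P \<and> P dvd H \<and> value_at P q = 0"
  using assms
proof (induction H rule: prime_divisors_induct)
  case (factor p x)
  thus ?case
    by (auto simp: comm_ring_hom.hom_mult[OF comm_ring_hom_value_at] intro: dvd_mult)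
qed (use value_at_unit_nonzero in auto)

text \<open>A point where \<open>H\<close> vanishes is a zero of some prime factor of \<open>H\<close>, hence of a component.\<close>
lemma div_support_zero_divisor:
  assumes "H \<noteq> 0" "bihomogeneous H"
  shows "div_support (zero_divisor H) = zero_locus H"
proof
  show "div_support (zero_divisor H) \<subseteq> zero_locus H"
  proof
    fix q assume "q \<in> div_support (zero_divisor H)"
    then obtain D where D: "zero_divisor H D \<noteq> 0" "q \<in> D" by (auto simp: div_support_def)
    hence "prime_divisor D" by (auto simp: zero_divisor_def split: if_splits)
    then obtain P where P: "irreducible P" "bihomogeneous P" "D = zero_locus P"
      by (auto simp: prime_divisor_def)
    hence "multiplicity P H \<noteq> 0" using D zero_divisor_zero_locus by simp
    hence "P dvd H" by (metis not_dvd_imp_multiplicity_0)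
    thus "q \<in> zero_locus H" using D P zero_locus_mono by blast
  qed
  show "zero_locus H \<subseteq> div_support (zero_divisor H)"
  proof
    fix q assume "q \<in> zero_locus H"
    hence "value_at H q = 0" by (simp add: zero_locus_def)
    then obtain P where P: "prime P" "P dvd H" "value_at P q = 0"
      using vanishing_prime_factor[OF assms(1)] by blast
    have ir: "irreducible P" using P(1) by (auto intro: prime_elem_imp_irreducible)
    have "bihomogeneous P" using bihomogeneous_factor assms P by blast
    hence "zero_divisor H (zero_locus P) = multiplicity P H" using zero_divisor_zero_locus ir by blast
    moreover have "multiplicity P H \<noteq> 0"
      using P ir assms by (simp add: multiplicity_eq_zero_iff irreducible_not_unit)
    ultimately have "zero_divisor H (zero_locus P) \<noteq> 0" by simp
    moreover have "q \<in> zero_locus P" using P(3) by (simp add: zero_locus_def)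
    ultimately show "q \<in> div_support (zero_divisor H)"
      unfolding div_support_def by blast
  qed
qed

section \<open>The pencil of pull-backs of points\<close>

lemma linear_form_hom:
  assumes "comm_ring_hom f"
  shows "f (linear_form emb p (U, V)) = linear_form (\<lambda>c. f (emb c)) p (f U, f V)"
  by (cases p) (simp_all add: comm_ring_hom.hom_diff[OF assms] comm_ring_hom.hom_mult[OF assms])

lemma value_at_linear_form:
  "value_at (linear_form hconst p (N, D)) q =
     linear_form (\<lambda>c. c) p (value_at N q, value_at D q)"
  using linear_form_hom[OF comm_ring_hom_value_at] by (simp add: value_at_hconst)

lemma bihomogeneous_of_linear_form:
  assumes "bihomogeneous_of a b N" "bihomogeneous_of a b D"
  shows "bihomogeneous_of a b (linear_form hconst p (N, D))"
proof (cases p)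
  case (Fin c)
  show ?thesis unfolding Fin linear_form.simps bihomogeneous_of_def
  proof (intro allI impI)
    fix i j k l
    assume "coeff (coeff (coeff (coeff (N - hconst c * D) i) j) k) l \<noteq> 0"
    hence "coeff (coeff (coeff (coeff N i) j) k) l \<noteq> 0 \<or> coeff (coeff (coeff (coeff D i) j) k) l \<noteq> 0"
      by (auto simp: hconst_def)
    thus "i + k = a \<and> j + l = b" using assms unfolding bihomogeneous_of_def by blast
  qed
qed (use assms in simp)

lemma linear_forms_common_zero:
  fixes U V :: complex
  assumes "p \<noteq> p'" "linear_form (\<lambda>c. c) p (U, V) = 0" "linear_form (\<lambda>c. c) p' (U, V) = 0"
  shows "U = 0 \<and> V = 0"
  using assms by (cases p; cases p') auto

text \<open>At a zero of the form of \<open>p3\<close>, the pair \<open>(U, V)\<close> is a multiple of the coordinates of \<open>p3\<close>.\<close>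
lemma linear_forms_ratio:
  assumes "p2 \<noteq> p3" "(U, V) \<noteq> (0, 0)" "linear_form (\<lambda>c. c) p3 (U, V) = 0"
  shows "linear_form (\<lambda>c. c) p1 (U, V) / linear_form (\<lambda>c. c) p2 (U, V) = linear_ratio_at p1 p2 p3"
proof -
  obtain t p where t: "t \<noteq> 0" "(U, V) = (t * fst (hcoords p), t * snd (hcoords p))"
    using homogeneous_coordinates[OF assms(2)] by blast
  have scale: "linear_form (\<lambda>c. c) r (U, V) = t * linear_form (\<lambda>c. c) r (hcoords p)" for r
    using t by (cases r; cases "hcoords p") (auto simp: algebra_simps)
  have "linear_form (\<lambda>c. c) p3 (hcoords p) = 0" using scale assms t by simp
  hence "p = p3" by (cases p; cases p3) auto
  thus ?thesis by (simp add: scale linear_ratio_at_def t(1))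
qed

text \<open>Two different members of the pencil span it, so a common divisor divides \<open>N\<close> and \<open>D\<close>.\<close>
lemma dvd_linear_forms:
  assumes "p \<noteq> p'" "Q dvd linear_form hconst p (N, D)" "Q dvd linear_form hconst p' (N, D)"
  shows "Q dvd N \<and> Q dvd D"
proof (cases p; cases p')
  fix a b assume ab: "p = Fin a" "p' = Fin b"
  have "Q dvd (N - hconst a * D) - (N - hconst b * D)"
    using assms ab by (simp only: linear_form.simps dvd_diff)
  also have "(N - hconst a * D) - (N - hconst b * D) = hconst (b - a) * D"
  proof -
    have "hconst (b - a) = hconst b - hconst a" by (simp add: hconst_def)
    show ?thesis unfolding \<open>hconst (b - a) = hconst b - hconst a\<close> by (simp add: algebra_simps)
  qed
  finally have "Q dvd D"
    using assms ab hconst_dvd_one[of "b - a"] dvd_mult_unit_iff' by auto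
  moreover from this have "Q dvd (N - hconst a * D) + hconst a * D"
    using assms ab by (intro dvd_add[OF _ dvd_mult]) auto
  ultimately show ?thesis by simp
next
  fix a assume a: "p = Fin a" "p' = Infty"
  hence "Q dvd (N - hconst a * D) + hconst a * D" using assms by (intro dvd_add[OF _ dvd_mult]) auto
  thus ?thesis using a assms by simp
next
  fix a assume a: "p = Infty" "p' = Fin a"
  hence "Q dvd (N - hconst a * D) + hconst a * D" using assms by (intro dvd_add[OF _ dvd_mult]) auto
  thus ?thesis using a assms by simp
qed (use assms in auto)

lemma bihomogeneous_of_0_0:
  assumes "bihomogeneous_of 0 0 H"
  obtains c where "H = hconst c"
proof (rule that)
  show "H = hconst (coeff (coeff (coeff (coeff H 0) 0) 0) 0)"
    using assms
    by (auto simp: poly_eq_iff hconst_def coeff_pCons bihomogeneous_of_def split: nat.splits)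
qed

text \<open>
  If some member of the pencil is a constant, the bidegree is \<open>(0, 0)\<close> and \<open>[N : D]\<close> is a constant
  point; the member that belongs to this point is zero.
\<close>
lemma linear_form_not_unit:
  assumes "bihomogeneous_of a b N" "bihomogeneous_of a b D"
    and nondeg: "\<And>p. linear_form hconst p (N, D) \<noteq> 0"
  shows "\<not> linear_form hconst p (N, D) dvd 1"
proof
  assume "linear_form hconst p (N, D) dvd 1"
  then obtain c where c: "c \<noteq> 0" "linear_form hconst p (N, D) = hconst c" by (rule is_unit_hpolyE)
  have "bihomogeneous_of a b (hconst c)"
    using bihomogeneous_of_linear_form[OF assms(1,2), of p] c by simp
  moreover have "coeff (coeff (coeff (coeff (hconst c) 0) 0) 0) 0 \<noteq> 0"
    using c by (simp add: hconst_def)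
  ultimately have "a = 0" "b = 0"
    unfolding bihomogeneous_of_def by (metis add_is_0)+
  then obtain n d where nd: "N = hconst n" "D = hconst d"
    using assms bihomogeneous_of_0_0 by metis
  have "linear_form hconst (point_of_ratio n d) (N, D) = 0"
    by (simp add: nd point_of_ratio_def hconst_def)
  with nondeg show False by blast
qed

section \<open>The affine formula\<close>

lemma comm_ring_hom_affine: "comm_ring_hom (\<lambda>H. to_fract (dehomogenize H))"
  by unfold_locales (simp_all add: dehomogenize_def)

lemma affine_hconst: "to_fract (dehomogenize (hconst c)) = rconst c"
  by (simp add: dehomogenize_def hconst_def rconst_def)

lemma heval_affine_chart: "heval H (u, 1) (w, 1) = poly (poly (dehomogenize H) [:u:]) w"
  by (simp add: heval_def dehomogenize_def one_pCons[symmetric])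

text \<open>
  By rescaling, a bihomogeneous polynomial that vanishes on the affine chart vanishes wherever
  \<open>X1\<close> and \<open>Y1\<close> do not; its product with \<open>X1 * Y1\<close> then vanishes everywhere.
\<close>
lemma dehomogenize_eq_0_imp:
  assumes "bihomogeneous H" "dehomogenize H = 0"
  shows "H = 0"
proof (rule ccontr)
  assume "H \<noteq> 0"
  hence "H * X1 * Y1 \<noteq> 0" by (simp add: X1_def Y1_def)
  then obtain u v w z where "heval (H * X1 * Y1) (u, v) (w, z) \<noteq> 0"
    using separating_points_heval unfolding separating_points_def by blast
  hence nz: "heval H (u, v) (w, z) \<noteq> 0" "v \<noteq> 0" "z \<noteq> 0"
    by (auto simp: comm_ring_hom.hom_mult[OF comm_ring_hom_heval] heval_coordinates)
  obtain a b where "bihomogeneous_of a b H" using assms(1) by (auto simp: bihomogeneous_def)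
  from heval_scale[OF this, of v "u / v" 1 z "w / z" 1] nz assms(2) show False
    by (simp add: heval_affine_chart)
qed

text \<open>
  The affine form of a finite point is the homogeneous one divided by \<open>v\<close>, whereas the affine form of
  \<open>Infty\<close> is \<open>1 = v / v\<close>. Both are the homogeneous form divided by \<open>v\<close>, which cancels in the ratio.
\<close>
lemma lbar_ratio:
  assumes "v \<noteq> 0"
  shows "lbar p1 (u / v) / lbar p2 (u / v) = linear_form rconst p1 (u, v) / linear_form rconst p2 (u, v)"
proof -
  have "lbar p (u / v) = (if p = Infty then 1 else linear_form rconst p (u, v) / v)" for p
    using assms by (cases p) (auto simp: field_simps)
  thus ?thesis using assms by (cases p1; cases p2) auto
qed

lemma rconst_eq_iff: "rconst a = rconst b \<longleftrightarrow> a = b"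
  by (simp add: rconst_def)

text \<open>
  A Moebius transformation is injective. The value 0 is excluded because, by the convention on
  division by zero, the ratio takes it also at a finite pole.
\<close>
lemma lbar_ratio_inj:
  assumes "p1 \<noteq> p2" "lbar p1 \<xi> / lbar p2 \<xi> = lbar p1 \<xi>' / lbar p2 \<xi>'" "lbar p1 \<xi> / lbar p2 \<xi> \<noteq> 0"
  shows "\<xi> = \<xi>'"
proof (cases p1; cases p2)
  fix a b assume ab: "p1 = Fin a" "p2 = Fin b"
  have nz: "\<xi> - rconst b \<noteq> 0" "\<xi>' - rconst b \<noteq> 0" using assms ab by auto
  hence "(\<xi> - rconst a) * (\<xi>' - rconst b) = (\<xi>' - rconst a) * (\<xi> - rconst b)"
    using assms(2) ab by (simp add: frac_eq_eq)
  hence "(rconst a - rconst b) * (\<xi> - \<xi>') = 0" by (simp add: algebra_simps)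
  moreover have "rconst a - rconst b \<noteq> 0" using assms(1) ab by (simp add: rconst_eq_iff)
  ultimately show ?thesis by simp
qed (use assms in auto)

text \<open>
  The theorem for one component \<open>[N : D]\<close>. The form \<open>L p\<close> of a point is a constant times the product
  of the defining polynomials of its divisor; the quotient of the constants for \<open>p1\<close> and \<open>p2\<close> is \<open>C\<close>.
  For the third point, some prime factor \<open>Q\<close> of \<open>L p3\<close> has a zero outside the divisor of \<open>p1\<close>, as it
  would otherwise divide \<open>L p1\<close>, against the coprimality of \<open>N\<close> and \<open>D\<close>. At such a point \<open>N\<close> and \<open>D\<close>
  are not both zero, so that \<open>L p2\<close> is nonzero too.
\<close>
lemma pencil_formula:
  assumes "coprime N D" and NH: "bihomogeneous_of a b N" and DH: "bihomogeneous_of a b D"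
    and nondeg: "\<And>p. linear_form hconst p (N, D) \<noteq> 0"
    and "p1 \<noteq> p2"
    and dec1: "prime_decomposition (zero_divisor (linear_form hconst p1 (N, D))) n1 m1 P1"
    and dec2: "prime_decomposition (zero_divisor (linear_form hconst p2 (N, D))) n2 m2 P2"
  shows "\<exists>C. C \<noteq> 0 \<and>
    (\<forall>\<xi>. \<xi> = to_fract (dehomogenize N) / to_fract (dehomogenize D) \<longleftrightarrow>
       lbar p1 \<xi> / lbar p2 \<xi> = rconst C *
         ((\<Prod>s=1..n1. to_fract (dehomogenize (P1 s)) ^ m1 s) /
          (\<Prod>s=1..n2. to_fract (dehomogenize (P2 s)) ^ m2 s))) \<and>
    (\<forall>p3. p3 \<noteq> p1 \<and> p3 \<noteq> p2 \<longrightarrow>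
       computed_from_third C p1 p2 p3
         (zero_divisor (linear_form hconst p1 (N, D)))
         (zero_divisor (linear_form hconst p2 (N, D)))
         (zero_divisor (linear_form hconst p3 (N, D)))
         (prime_prod n1 m1 P1) (prime_prod n2 m2 P2))"
proof -
  define L where "L p = linear_form hconst p (N, D)" for p
  define A where "A = prime_prod n1 m1 P1"
  define B where "B = prime_prod n2 m2 P2"
  define f :: "hpoly \<Rightarrow> ratfun" where "f = (\<lambda>H. to_fract (dehomogenize H))"
  interpret f: comm_ring_hom f unfolding f_def by (rule comm_ring_hom_affine)
  have L_bihom: "bihomogeneous (L p)" for p
    using bihomogeneous_of_linear_form[OF NH DH] by (auto simp: L_def bihomogeneous_def)
  have L_nz: "L p \<noteq> 0" for p using nondeg by (simp add: L_def)
  have L_support: "div_support (zero_divisor (L p)) = zero_locus (L p)" for p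
    by (rule div_support_zero_divisor[OF L_nz L_bihom])
  have L_value: "value_at (L p) q = linear_form (\<lambda>c. c) p (value_at N q, value_at D q)" for p q
    by (simp add: L_def value_at_linear_form)
  have f_nz: "f (L p) \<noteq> 0" for p
    using dehomogenize_eq_0_imp[OF L_bihom] L_nz by (auto simp: f_def)
  obtain c1 where c1: "c1 \<noteq> 0" "L p1 = hconst c1 * A"
    using prime_decomposition_zero_divisorD[OF dec1] L_nz L_bihom unfolding L_def A_def by blast
  obtain c2 where c2: "c2 \<noteq> 0" "L p2 = hconst c2 * B"
    using prime_decomposition_zero_divisorD[OF dec2] L_nz L_bihom unfolding L_def B_def by blast
  define C where "C = c1 / c2"
  have f_power: "f (F ^ k) = f F ^ k" for F k by (induction k) simp_all
  have f_prod: "f (prime_prod n m P) = (\<Prod>s=1..n. f (P s) ^ m s)" for n m P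
    unfolding prime_prod_def by (induction n) (simp_all add: f_power)
  have f_ratio: "f (L p1) / f (L p2) = rconst C * (f A / f B)"
  proof -
    have "rconst c1 = rconst C * rconst c2" "rconst c2 \<noteq> 0"
      using c2 by (simp_all add: C_def rconst_def flip: to_fract_mult)
    thus ?thesis
      by (simp add: c1 c2 f_def[THEN fun_cong, of "hconst _"] affine_hconst)
  qed
  have "f D \<noteq> 0" using f_nz[of Infty] by (simp add: L_def)
  define \<xi>0 where "\<xi>0 = f N / f D"
  have fL: "f (L p) = linear_form rconst p (f N, f D)" for p
    using linear_form_hom[OF f.comm_ring_hom_axioms, of hconst p N D]
    by (simp add: L_def f_def affine_hconst)
  have \<xi>0: "lbar p1 \<xi>0 / lbar p2 \<xi>0 = rconst C * (f A / f B)"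
    unfolding \<xi>0_def lbar_ratio[OF \<open>f D \<noteq> 0\<close>] fL[symmetric] by (rule f_ratio)
  moreover have "rconst C * (f A / f B) \<noteq> 0"
    unfolding f_ratio[symmetric] using f_nz by simp
  ultimately have formula: "\<xi> = \<xi>0 \<longleftrightarrow> lbar p1 \<xi> / lbar p2 \<xi> = rconst C * (f A / f B)" for \<xi>
    using lbar_ratio_inj[OF \<open>p1 \<noteq> p2\<close>] by metis
  have third: "computed_from_third C p1 p2 p3 (zero_divisor (L p1)) (zero_divisor (L p2))
      (zero_divisor (L p3)) A B" if p3: "p3 \<noteq> p1" "p3 \<noteq> p2" for p3
    unfolding computed_from_third_def L_support
  proof (intro conjI ballI)
    have "\<not> L p3 dvd 1" unfolding L_def by (rule linear_form_not_unit[OF NH DH nondeg])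
    then obtain Q where Q: "prime Q" "Q dvd L p3" using prime_divisor_exists L_nz by blast
    have "\<not> Q dvd L p1"
    proof
      assume "Q dvd L p1"
      hence "Q dvd N \<and> Q dvd D"
        using Q(2) p3(1) unfolding L_def by (intro dvd_linear_forms[of p3 p1])
      with \<open>coprime N D\<close> have "Q dvd 1" by (metis coprime_common_divisor)
      thus False using Q by (simp add: prime_def)
    qed
    moreover have "bihomogeneous Q" using bihomogeneous_factor L_bihom L_nz Q by blast
    ultimately have "\<not> zero_locus Q \<subseteq> zero_locus (L p1)"
      using prime_elem_dvd_if_zero_locus_subset[OF _ _ L_bihom] Q(1) by (metis prime_imp_prime_elem)
    then obtain q where q: "q \<in> zero_locus Q" "q \<notin> zero_locus (L p1)" by blast
    have "q \<in> zero_locus (L p3)" using q Q zero_locus_mono by blast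
    moreover have "q \<notin> zero_locus (L p2)"
    proof
      assume "q \<in> zero_locus (L p2)"
      with \<open>q \<in> zero_locus (L p3)\<close> have "value_at N q = 0 \<and> value_at D q = 0"
        by (intro linear_forms_common_zero[OF p3(2)]) (simp_all add: zero_locus_def L_value)
      hence "value_at (L p1) q = 0" unfolding L_value by (cases p1) simp_all
      thus False using q by (simp add: zero_locus_def)
    qed
    ultimately show "zero_locus (L p3) - zero_locus (L p1) - zero_locus (L p2) \<noteq> {}"
      using q by blast
  next
    fix q assume "q \<in> zero_locus (L p3) - zero_locus (L p1) - zero_locus (L p2)"
    hence q: "value_at (L p3) q = 0" "value_at (L p1) q \<noteq> 0" "value_at (L p2) q \<noteq> 0"
      by (auto simp: zero_locus_def)
    have "value_at (L p1) q = c1 * value_at A q" "value_at (L p2) q = c2 * value_at B q"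
      by (simp_all add: c1 c2 comm_ring_hom.hom_mult[OF comm_ring_hom_value_at] value_at_hconst)
    note AB = this
    show "value_at A q \<noteq> 0" using q AB by auto
    have "(value_at N q, value_at D q) \<noteq> (0, 0)"
      using q(2) unfolding L_value by (cases p1) auto
    hence "linear_ratio_at p1 p2 p3 = value_at (L p1) q / value_at (L p2) q"
      using linear_forms_ratio[of p2 p3] p3 q(1) unfolding L_value by metis
    thus "C = linear_ratio_at p1 p2 p3 * value_at B q / value_at A q"
      using q AB c1(1) c2(1) by (auto simp: C_def field_simps)
  qed
  have "C \<noteq> 0" using c1 c2 by (simp add: C_def)
  with formula third show ?thesis
    unfolding A_def B_def f_prod \<xi>0_def unfolding f_def L_def by blast
qed

lemma linear_form_hcoords_point_of_ratio:
  assumes "(U, V) \<noteq> (0, 0)" "linear_form (\<lambda>c. c) p (U, V) = 0"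
  shows "linear_form (\<lambda>c. c) p (hcoords (point_of_ratio U V)) = 0"
  using assms by (cases p) (auto simp: point_of_ratio_def)

lemma bihomogeneous_coordinates:
  "bihomogeneous_of 1 0 X0" "bihomogeneous_of 1 0 X1"
  "bihomogeneous_of 0 1 Y0" "bihomogeneous_of 0 1 Y1"
  by (auto simp: bihomogeneous_of_def X0_def X1_def Y0_def Y1_def coeff_pCons split: nat.splits)

lemma value_at_coordinates:
  "value_at X0 q = fst (hcoords (fst q))" "value_at X1 q = snd (hcoords (fst q))"
  "value_at Y0 q = fst (hcoords (snd q))" "value_at Y1 q = snd (hcoords (snd q))"
  by (cases "hcoords (fst q)"; cases "hcoords (snd q)"; simp add: value_at_def heval_coordinates)+

lemma linear_form_nonzero_somewhere:
  "\<exists>p'. linear_form (\<lambda>c. c) p (hcoords p') \<noteq> 0"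
  by (rule exI[of _ "if p = Infty then Fin 0 else Infty"], cases p) simp_all

text \<open>
  If the form of \<open>p\<close> vanished identically on a component of the map, the image would lie in the
  fibre over \<open>p\<close>, a proper closed subset. In particular no component is constant, since the form of
  its value would vanish on it.
\<close>
lemma dominant_linear_form_nonzero:
  assumes "dominant \<phi>"
  shows "linear_form hconst p (num_x \<phi>, den_x \<phi>) \<noteq> 0"
    and "linear_form hconst p (num_y \<phi>, den_y \<phi>) \<noteq> 0"
proof -
  have dense: "zero_locus H = UNIV"
    if "bihomogeneous H" "\<And>q. q \<in> map_domain \<phi> \<Longrightarrow> value_at H (map_at \<phi> q) = 0" for H
    using assms that unfolding dominant_def zariski_dense_def zero_locus_def by blast
  \<comment> \<open>\<open>U\<close>, \<open>V\<close> are the coordinates of the factor of the target that contains \<open>[N : D]\<close>.\<close>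
  have pencil_nonzero: "linear_form hconst p (N, D) \<noteq> 0"
    if bihom: "bihomogeneous_of a b U" "bihomogeneous_of a b V"
      and defined: "\<And>q. q \<in> map_domain \<phi> \<Longrightarrow> (value_at N q, value_at D q) \<noteq> (0, 0)"
      and image: "\<And>q. (value_at U (map_at \<phi> q), value_at V (map_at \<phi> q)) =
                   hcoords (point_of_ratio (value_at N q) (value_at D q))"
      and coords: "\<And>p'. (value_at U (p', p'), value_at V (p', p')) = hcoords p'"
    for N D U V a b
  proof
    assume zero: "linear_form hconst p (N, D) = 0"
    let ?H = "linear_form hconst p (U, V)"
    have "linear_form (\<lambda>c. c) p (value_at N q, value_at D q) = 0" for q
      using arg_cong[OF zero, of "\<lambda>H. value_at H q"]
      by (simp add: value_at_linear_form comm_ring_hom.hom_zero[OF comm_ring_hom_value_at])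
    hence "value_at ?H (map_at \<phi> q) = 0" if "q \<in> map_domain \<phi>" for q
      using linear_form_hcoords_point_of_ratio[OF defined[OF that]]
      by (simp only: value_at_linear_form image)
    moreover have "bihomogeneous ?H"
      using bihomogeneous_of_linear_form[OF bihom] unfolding bihomogeneous_def by blast
    ultimately have "zero_locus ?H = UNIV" by (rule dense[rotated])
    hence "value_at ?H (p', p') = 0" for p' by (auto simp: zero_locus_def)
    thus False using linear_form_nonzero_somewhere[of p]
      by (simp only: value_at_linear_form coords simp_thms)
  qed
  show "linear_form hconst p (num_x \<phi>, den_x \<phi>) \<noteq> 0"
    by (rule pencil_nonzero[OF bihomogeneous_coordinates(1,2)])
       (auto simp: value_at_coordinates map_at_def map_domain_def)
  show "linear_form hconst p (num_y \<phi>, den_y \<phi>) \<noteq> 0"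
    by (rule pencil_nonzero[OF bihomogeneous_coordinates(3,4)])
       (auto simp: value_at_coordinates map_at_def map_domain_def)
qed

theorem proposition2p1:
  fixes \<phi> :: biproj_map
    and x1 x2 y1 y2 :: proj_line
    and S :: "nat \<Rightarrow> nat"
    and m :: "nat \<Rightarrow> nat \<Rightarrow> nat"
    and P :: "nat \<Rightarrow> nat \<Rightarrow> hpoly"
    and p :: "nat \<Rightarrow> nat \<Rightarrow> ratfun"
  assumes "rational_map \<phi>" and "dominant \<phi>"
    and "x1 \<noteq> x2" and "y1 \<noteq> y2"
    and "prime_decomposition (pullback_x \<phi> x1) (S 1) (m 1) (P 1)"
    and "prime_decomposition (pullback_x \<phi> x2) (S 2) (m 2) (P 2)"
    and "prime_decomposition (pullback_y \<phi> y1) (S 3) (m 3) (P 3)"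
    and "prime_decomposition (pullback_y \<phi> y2) (S 4) (m 4) (P 4)"
    and "\<And>i s. p i s = to_fract (dehomogenize (P i s))"
  shows "\<exists>C1 C2. C1 \<noteq> 0 \<and> C2 \<noteq> 0 \<and>
    (\<forall>\<xi> \<eta>. (\<xi> = affine_x \<phi> \<and> \<eta> = affine_y \<phi>) \<longleftrightarrow>
       (lbar x1 \<xi> / lbar x2 \<xi> =
          rconst C1 * ((\<Prod>s=1..S 1. p 1 s ^ m 1 s) / (\<Prod>s=1..S 2. p 2 s ^ m 2 s)) \<and>
        lbar y1 \<eta> / lbar y2 \<eta> =
          rconst C2 * ((\<Prod>s=1..S 3. p 3 s ^ m 3 s) / (\<Prod>s=1..S 4. p 4 s ^ m 4 s)))) \<and>
    (\<forall>x3. x3 \<noteq> x1 \<and> x3 \<noteq> x2 \<longrightarrow>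
       computed_from_third C1 x1 x2 x3
         (pullback_x \<phi> x1) (pullback_x \<phi> x2) (pullback_x \<phi> x3)
         (prime_prod (S 1) (m 1) (P 1)) (prime_prod (S 2) (m 2) (P 2))) \<and>
    (\<forall>y3. y3 \<noteq> y1 \<and> y3 \<noteq> y2 \<longrightarrow>
       computed_from_third C2 y1 y2 y3
         (pullback_y \<phi> y1) (pullback_y \<phi> y2) (pullback_y \<phi> y3)
         (prime_prod (S 3) (m 3) (P 3)) (prime_prod (S 4) (m 4) (P 4)))"
proof -
  obtain a b where x: "coprime (num_x \<phi>) (den_x \<phi>)"
    "bihomogeneous_of a b (num_x \<phi>)" "bihomogeneous_of a b (den_x \<phi>)"
    using assms(1) by (auto simp: rational_map_def)
  obtain a' b' where y: "coprime (num_y \<phi>) (den_y \<phi>)"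
    "bihomogeneous_of a' b' (num_y \<phi>)" "bihomogeneous_of a' b' (den_y \<phi>)"
    using assms(1) by (auto simp: rational_map_def)
  note nondeg = dominant_linear_form_nonzero[OF \<open>dominant \<phi>\<close>]
  let ?R = "\<lambda>i j. (\<Prod>s=1..S i. p i s ^ m i s) / (\<Prod>s=1..S j. p j s ^ m j s)"
  obtain C1 where C1: "C1 \<noteq> 0"
    "\<And>\<xi>. \<xi> = affine_x \<phi> \<longleftrightarrow> lbar x1 \<xi> / lbar x2 \<xi> = rconst C1 * ?R 1 2"
    "\<And>x3. x3 \<noteq> x1 \<and> x3 \<noteq> x2 \<Longrightarrow> computed_from_third C1 x1 x2 x3
       (pullback_x \<phi> x1) (pullback_x \<phi> x2) (pullback_x \<phi> x3)
       (prime_prod (S 1) (m 1) (P 1)) (prime_prod (S 2) (m 2) (P 2))"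
    using pencil_formula[OF x nondeg(1) \<open>x1 \<noteq> x2\<close> assms(5,6)[unfolded pullback_x_def]]
    unfolding assms(9) pullback_x_def affine_x_def by blast
  obtain C2 where C2: "C2 \<noteq> 0"
    "\<And>\<eta>. \<eta> = affine_y \<phi> \<longleftrightarrow> lbar y1 \<eta> / lbar y2 \<eta> = rconst C2 * ?R 3 4"
    "\<And>y3. y3 \<noteq> y1 \<and> y3 \<noteq> y2 \<Longrightarrow> computed_from_third C2 y1 y2 y3
       (pullback_y \<phi> y1) (pullback_y \<phi> y2) (pullback_y \<phi> y3)
       (prime_prod (S 3) (m 3) (P 3)) (prime_prod (S 4) (m 4) (P 4))"
    using pencil_formula[OF y nondeg(2) \<open>y1 \<noteq> y2\<close> assms(7,8)[unfolded pullback_y_def]]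
    unfolding assms(9) pullback_y_def affine_y_def by blast
  show ?thesis
    by (rule exI[of _ C1], rule exI[of _ C2]) (intro conjI allI impI; simp only: C1 C2 simp_thms)
qed

end
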